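(* Let $n\ge 2$ and let $G=P_n$ be the path on $n$ vertices. Then $$\zeta(G)=\begin{cases}1, & \text{if } n\equiv 0 \pmod 3,\\ \dfrac{(n+2)(n+11)}{18}-1, & \text{if } n\equiv 1\pmod 3,\\ \left\lceil \dfrac{n}{3}\right\rceil+1, & \text{if } n\equiv 2\pmod 3.\end{cases}$$
   Context: All graphs are finite and simple. For a graph $G=(V,E)$, a set $S\subseteq V$ is a dominating set if every vertex of $V\setminus S$ is adjacent to some vertex of $S$. The domination number $\gamma(G)$ is the minimum cardinality of a dominating set; a dominating set of cardinality $\gamma(G)$ is called a $\gamma$-set. The dominion $\zeta(G)$ is the number of $\gamma$-sets of $G$. *)

theory Defs
  imports Complex_Main "Graph_Theory.Pair_Digraph"
begin

text \<open>
  Finite simple graphs are symmetric loop-free finite digraphs whose arcs are pairs of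
  vertices (locale \<^locale>\<open>pair_graph\<close>); the edge \<open>{u, v}\<close> is represented by the two arcs
  \<open>(u, v)\<close> and \<open>(v, u)\<close>.  The definitions below are meant for such graphs.
\<close>

definition dominating_set :: "'a pair_pre_digraph \<Rightarrow> 'a set \<Rightarrow> bool" where
  "dominating_set G S \<longleftrightarrow>
     S \<subseteq> pverts G \<and> (\<forall>v \<in> pverts G - S. \<exists>u \<in> S. (v, u) \<in> parcs G)"

definition domination_number :: "'a pair_pre_digraph \<Rightarrow> nat" where
  "domination_number G = (LEAST k. \<exists>S. dominating_set G S \<and> card S = k)"

definition gamma_set :: "'a pair_pre_digraph \<Rightarrow> 'a set \<Rightarrow> bool" where
  "gamma_set G S \<longleftrightarrow> dominating_set G S \<and> card S = domination_number G"

definition dominion :: "'a pair_pre_digraph \<Rightarrow> nat" where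
  "dominion G = card {S. gamma_set G S}"

text \<open>The path on \<open>n\<close> vertices is taken up to isomorphism: \<open>v 1, \<dots>, v n\<close> enumerates the
  vertices in the order in which they occur along the path.\<close>

definition is_path_graph :: "nat \<Rightarrow> 'a pair_pre_digraph \<Rightarrow> bool" where
  "is_path_graph n G \<longleftrightarrow>
     (\<exists>v. bij_betw v {1..n} (pverts G) \<and>
          parcs G = {(v i, v j) | i j. i \<in> {1..n} \<and> j \<in> {1..n} \<and> (j = i + 1 \<or> i = j + 1)})"

lemma pair_graph_if_is_path_graph:
  assumes "is_path_graph n G"
  shows "pair_graph G"
proof -
  obtain v where v: "bij_betw v {1..n} (pverts G)"
    and arcs: "parcs G = {(v i, v j) | i j. i \<in> {1..n} \<and> j \<in> {1..n} \<and> (j = i + 1 \<or> i = j + 1)}"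
    using assms unfolding is_path_graph_def by blast
  have img: "pverts G = v ` {1..n}" and inj: "inj_on v {1..n}"
    using v by (auto simp: bij_betw_def)
  have sub: "parcs G \<subseteq> pverts G \<times> pverts G"
    unfolding arcs img by blast
  have fin: "finite (pverts G)"
    unfolding img by simp
  show ?thesis
  proof
    show "finite (pverts G)" by (rule fin)
    show "finite (parcs G)"
      using sub fin by (meson finite_SigmaI finite_subset)
    show "fst e \<in> pverts G" if "e \<in> parcs G" for e
      using that sub by auto
    show "snd e \<in> pverts G" if "e \<in> parcs G" for e
      using that sub by auto
    show "fst e \<noteq> snd e" if "e \<in> parcs G" for e
    proof
      assume eq: "fst e = snd e"
      obtain i j where ij: "e = (v i, v j)" "i \<in> {1..n}" "j \<in> {1..n}" "j = i + 1 \<or> i = j + 1"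
        using \<open>e \<in> parcs G\<close> unfolding arcs by blast
      then have "i = j"
        using eq inj_onD[OF inj, of i j] by simp
      then show False
        using ij by simp
    qed
    show "symmetric (with_proj G)"
      unfolding symmetric_def sym_def by (auto simp: arcs)
  qed
qed

lemma is_path_graph_card: "is_path_graph n G \<Longrightarrow> card (pverts G) = n"
  unfolding is_path_graph_def by (auto dest: bij_betw_same_card)

lemma is_path_graph_exists:
  "is_path_graph n
     \<lparr>pverts = {1..n}, parcs = {(i, j). i \<in> {1..n} \<and> j \<in> {1..n} \<and> (j = i + 1 \<or> i = j + 1)}\<rparr>"
  unfolding is_path_graph_def by (rule exI[of _ id]) auto

end

theory Submission
  imports Defs
begin

text \<open>
  A set \<open>x\<^sub>1 < \<dots> < x\<^sub>m\<close> dominates the path \<open>1, \<dots>, n\<close> iff \<open>x\<^sub>1 \<le> 2\<close>, consecutive elements differ by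
  at most 3, and \<open>x\<^sub>m \<ge> n - 1\<close>.  Hence the dominating sets of size \<open>m\<close> with prescribed largest
  element satisfy a three-term recurrence obtained by deleting that element.  As \<open>m\<close> vertices
  dominate at most \<open>3 m\<close> vertices, a \<open>\<gamma>\<close>-set has slack \<open>3 m - n \<le> 2\<close>, so only the values of
  the recurrence for slack at most 2 are needed.
\<close>

section \<open>Dominating sets of an integer interval, split by largest element\<close>

definition path_dominates :: "nat set \<Rightarrow> nat \<Rightarrow> bool" where
  "path_dominates S n \<longleftrightarrow> (\<forall>i\<in>{1..n}. \<exists>u\<in>S. u \<le> i + 1 \<and> i \<le> u + 1)"

definition path_dominating_sets :: "nat \<Rightarrow> nat \<Rightarrow> nat set set" where
  "path_dominating_sets n m = {S. S \<subseteq> {1..n} \<and> card S = m \<and> path_dominates S n}"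

text \<open>Members lie in \<open>{1..x}\<close>, so \<open>x\<close> is their maximum. The path is
  cut off at \<open>x\<close>, which separates the conditions on gaps from the condition at the
  right end.\<close>

definition dominating_sets_ending_at :: "nat \<Rightarrow> nat \<Rightarrow> nat set set" where
  "dominating_sets_ending_at x m = {S \<in> path_dominating_sets x m. x \<in> S}"

text \<open>The closed neighbourhoods of the elements of \<open>S\<close> cover the path, and each
  has at most three vertices. Truncation of \<open>u - 1\<close> at \<open>u = 0\<close> only makes
  one of them smaller.\<close>

lemma path_dominates_card:
  assumes "finite S" "path_dominates S n"
  shows "n \<le> 3 * card S"
proof -
  have "{1..n} \<subseteq> (\<Union>u\<in>S. {u - 1..u + 1})"
    using assms(2) unfolding path_dominates_def by fastforce
  then have "card {1..n} \<le> card (\<Union>u\<in>S. {u - 1..u + 1})"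
    using assms(1) by (intro card_mono) auto
  also have "\<dots> \<le> (\<Sum>u\<in>S. card {u - 1..u + 1})"
    using assms(1) by (rule card_UN_le)
  also have "\<dots> \<le> (\<Sum>u\<in>S. 3)"
    by (intro sum_mono) auto
  finally show ?thesis by simp
qed

lemma finite_path_dominating_sets [simp]: "finite (path_dominating_sets n m)"
  unfolding path_dominating_sets_def by (rule finite_subset[of _ "Pow {1..n}"]) auto

lemma finite_dominating_sets_ending_at [simp]: "finite (dominating_sets_ending_at x m)"
  unfolding dominating_sets_ending_at_def by simp

lemma path_dominating_sets_empty:
  assumes "3 * m < n"
  shows "path_dominating_sets n m = {}"
proof -
  have "n \<le> 3 * m" if "S \<in> path_dominating_sets n m" for S
    using that path_dominates_card[of S n] finite_subset[of S "{1..n}"]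
    by (auto simp: path_dominating_sets_def)
  with assms show ?thesis by fastforce
qed

text \<open>A set containing \<open>x\<close> also dominates \<open>x + 1\<close>, so it must
  already cover \<open>x + 1\<close> vertices. This gains one over the general size bound.\<close>

lemma dominating_sets_ending_at_empty:
  assumes "3 * m \<le> x"
  shows "dominating_sets_ending_at x m = {}"
proof -
  have "S \<in> path_dominating_sets (Suc x) m" if "S \<in> dominating_sets_ending_at x m" for S
    using that unfolding dominating_sets_ending_at_def path_dominating_sets_def path_dominates_def
    by (fastforce simp: le_Suc_eq)
  with path_dominating_sets_empty[of m "Suc x"] assms show ?thesis by fastforce
qed

lemma dominating_sets_ending_at_disjoint:
  "x < y \<Longrightarrow> dominating_sets_ending_at x k \<inter> dominating_sets_ending_at y m = {}"
  by (fastforce simp: dominating_sets_ending_at_def path_dominating_sets_def)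

text \<open>The last vertex can only be dominated by itself or by its predecessor, so the largest
  element is one of these two. Conversely, a set ending at the predecessor dominates the last vertex
  as well.\<close>

lemma card_path_dominating_sets:
  "card (path_dominating_sets (Suc (Suc n)) m) =
     card (dominating_sets_ending_at (Suc n) m) + card (dominating_sets_ending_at (Suc (Suc n)) m)"
proof -
  have "path_dominating_sets (Suc (Suc n)) m =
      dominating_sets_ending_at (Suc n) m \<union> dominating_sets_ending_at (Suc (Suc n)) m" (is "?L = ?R")
  proof (rule set_eqI)
    fix S
    show "S \<in> ?L \<longleftrightarrow> S \<in> ?R"
    proof
      assume S: "S \<in> ?L"
      show "S \<in> ?R"
      proof (cases "Suc (Suc n) \<in> S")
        case True
        with S show ?thesis by (simp add: dominating_sets_ending_at_def)
      next
        case False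
        from S have sub: "S \<subseteq> {1..Suc (Suc n)}" and dom: "path_dominates S (Suc (Suc n))"
          by (auto simp: path_dominating_sets_def)
        have sub': "S \<subseteq> {1..Suc n}"
          using sub False by (auto simp: subset_iff le_Suc_eq)
        obtain u where "u \<in> S" "Suc (Suc n) \<le> u + 1"
          using dom unfolding path_dominates_def by force
        with sub' have "Suc n \<in> S" by (metis Suc_eq_plus1 Suc_le_mono atLeastAtMost_iff le_antisym subsetD)
        with S sub' show ?thesis
          by (auto simp: dominating_sets_ending_at_def path_dominating_sets_def path_dominates_def)
      qed
    next
      assume "S \<in> ?R"
      then show "S \<in> ?L"
        unfolding dominating_sets_ending_at_def path_dominating_sets_def path_dominates_def
        by (fastforce simp: le_Suc_eq)
    qed
  qed
  then show ?thesis
    by (simp add: card_Un_disjoint dominating_sets_ending_at_disjoint)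
qed

lemma dominating_sets_ending_at_rec:
  assumes "m > 0"
  shows "dominating_sets_ending_at (y + 3) (Suc m) =
    insert (y + 3) ` (\<Union>z\<in>{y..y + 2}. dominating_sets_ending_at z m)" (is "?L = ?R")
proof (intro equalityI subsetI)
  fix S assume "S \<in> ?L"
  then have sub: "S \<subseteq> {1..y + 3}" and card: "card S = Suc m" and top: "y + 3 \<in> S"
    and dom: "path_dominates S (y + 3)"
    by (auto simp: dominating_sets_ending_at_def path_dominating_sets_def)
  define T where "T = S - {y + 3}"
  define z where "z = Max T"
  have fin: "finite S" using sub finite_subset by blast
  have finT: "finite T" and cardT: "card T = m"
    using fin card top by (auto simp: T_def)
  have zT: "z \<in> T" and maxT: "\<And>u. u \<in> T \<Longrightarrow> u \<le> z"
    using finT cardT assms by (auto simp: z_def intro: Max_in)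
  \<comment> \<open>The vertex \<open>y + 1\<close> is out of reach of \<open>y + 3\<close>, so its
    dominator survives in \<open>T\<close> and forces \<open>z\<close> to be at least
    \<open>y\<close>.\<close>
  obtain u where u: "u \<in> S" "u \<le> y + 1 + 1" "y + 1 \<le> u + 1"
    using dom unfolding path_dominates_def by force
  then have "u \<in> T" by (simp add: T_def)
  with u maxT have "y \<le> z" by fastforce
  have "z \<le> y + 2"
    using zT sub by (force simp: T_def)
  have "path_dominates T z"
    unfolding path_dominates_def
  proof
    fix i assume i: "i \<in> {1..z}"
    with \<open>z \<le> y + 2\<close> have "i \<in> {1..y + 3}" by simp
    with dom obtain w where w: "w \<in> S" "w \<le> i + 1" "i \<le> w + 1"
      unfolding path_dominates_def by blast
    show "\<exists>u\<in>T. u \<le> i + 1 \<and> i \<le> u + 1"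
    \<comment> \<open>Deleting \<open>y + 3\<close> can affect a vertex of \<open>{1..z}\<close>
      only if that vertex is \<open>y + 2 = z\<close>, which then dominates itself.\<close>
    proof (cases "w = y + 3")
      case True
      with w i \<open>z \<le> y + 2\<close> have "i = z" by simp
      with zT show ?thesis by (intro bexI[of _ z]) auto
    next
      case False
      with w show ?thesis by (auto simp: T_def)
    qed
  qed
  moreover have "T \<subseteq> {1..z}"
  proof
    fix u assume "u \<in> T"
    moreover from this have "u \<in> {1..y + 3}" using sub by (auto simp: T_def)
    ultimately show "u \<in> {1..z}" using maxT by simp
  qed
  ultimately have "T \<in> dominating_sets_ending_at z m"
    using cardT zT by (simp add: dominating_sets_ending_at_def path_dominating_sets_def)
  with \<open>y \<le> z\<close> \<open>z \<le> y + 2\<close> have "T \<in> (\<Union>z\<in>{y..y + 2}. dominating_sets_ending_at z m)"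
    by (intro UN_I[of z]) simp_all
  moreover have "S = insert (y + 3) T" using top by (auto simp: T_def)
  ultimately show "S \<in> ?R" by (rule rev_image_eqI)
next
  fix S assume "S \<in> ?R"
  then obtain z T where z: "y \<le> z" "z \<le> y + 2" and S: "S = insert (y + 3) T"
    and T: "T \<in> dominating_sets_ending_at z m"
    by auto
  from T have sub: "T \<subseteq> {1..z}" and card: "card T = m" and zT: "z \<in> T"
    and dom: "path_dominates T z"
    by (auto simp: dominating_sets_ending_at_def path_dominating_sets_def)
  have "finite T" using sub finite_subset by blast
  moreover have "y + 3 \<notin> T" using sub z by force
  ultimately have "card S = Suc m" using card S by simp
  moreover have "S \<subseteq> {1..y + 3}" using sub z S by force
  moreover have "path_dominates S (y + 3)"
    unfolding path_dominates_def
  proof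
    fix i assume i: "i \<in> {1..y + 3}"
    \<comment> \<open>From \<open>z \<ge> y\<close> it follows that no vertex lies strictly between
      \<open>z + 1\<close>, dominated by \<open>z\<close>, and \<open>y + 2\<close>, dominated by
      \<open>y + 3\<close>.\<close>
    consider "i \<le> z" | "i = z + 1" | "i \<ge> y + 2" using z by linarith
    then show "\<exists>u\<in>S. u \<le> i + 1 \<and> i \<le> u + 1"
    proof cases
      case 1
      with dom i S show ?thesis unfolding path_dominates_def by auto
    next
      case 2
      with zT S show ?thesis by (intro bexI[of _ z]) auto
    next
      case 3
      with i S show ?thesis by (intro bexI[of _ "y + 3"]) auto
    qed
  qed
  ultimately show "S \<in> ?L"
    using S by (simp add: dominating_sets_ending_at_def path_dominating_sets_def)
qed

text \<open>The three families are disjoint because their maxima differ, and inserting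
  \<open>y + 3\<close> is injective because it exceeds every element present.\<close>

lemma card_dominating_sets_ending_at_rec:
  assumes "m > 0"
  shows "card (dominating_sets_ending_at (y + 3) (Suc m)) =
    card (dominating_sets_ending_at y m) + card (dominating_sets_ending_at (y + 1) m)
      + card (dominating_sets_ending_at (y + 2) m)"
proof -
  let ?B = "\<lambda>z. dominating_sets_ending_at z m"
  have "inj_on (insert (y + 3)) (\<Union>z\<in>{y..y + 2}. ?B z)"
  proof (rule inj_onI)
    fix S T
    assume "S \<in> (\<Union>z\<in>{y..y + 2}. ?B z)" "T \<in> (\<Union>z\<in>{y..y + 2}. ?B z)"
      and eq: "insert (y + 3) S = insert (y + 3) T"
    then have "y + 3 \<notin> S" "y + 3 \<notin> T"
      by (fastforce simp: dominating_sets_ending_at_def path_dominating_sets_def)+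
    with eq show "S = T" by (simp add: insert_ident)
  qed
  then have "card (dominating_sets_ending_at (y + 3) (Suc m)) = card (\<Union>z\<in>{y..y + 2}. ?B z)"
    by (simp add: dominating_sets_ending_at_rec[OF assms] card_image)
  also have "\<dots> = (\<Sum>z\<in>{y..y + 2}. card (?B z))"
    by (intro card_UN_disjoint)
      (auto simp: neq_iff dest: dominating_sets_ending_at_disjoint)
  also have "\<dots> = card (?B y) + card (?B (y + 1)) + card (?B (y + 2))"
    by (simp add: numeral_2_eq_2)
  finally show ?thesis .
qed

section \<open>Closed forms for small slack\<close>

lemma card_dominating_sets_ending_at_1:
  "card (dominating_sets_ending_at 0 1) = 0"
  "card (dominating_sets_ending_at 1 1) = 1"
  "card (dominating_sets_ending_at 2 1) = 1"
proof -
  have "dominating_sets_ending_at 0 1 = {}"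
    by (auto simp: dominating_sets_ending_at_def path_dominating_sets_def)
  moreover have "dominating_sets_ending_at x 1 = {{x}}" if "x \<in> {1, 2}" for x
    using that
    by (auto simp: dominating_sets_ending_at_def path_dominating_sets_def path_dominates_def
        card_1_singleton_iff)
  ultimately show "card (dominating_sets_ending_at 0 1) = 0"
    "card (dominating_sets_ending_at 1 1) = 1" "card (dominating_sets_ending_at 2 1) = 1"
    by simp_all
qed

text \<open>Passing from \<open>k\<close> to \<open>k + 1\<close>, the first count is unchanged, the
  second grows by the first, and the third grows by the first two, that is by \<open>k + 2\<close>.
  Hence the values are constant, linear and quadratic; doubling the last avoids division.\<close>

lemma card_dominating_sets_ending_at:
  "card (dominating_sets_ending_at (3 * k + 2) (Suc k)) = 1"
  "card (dominating_sets_ending_at (3 * k + 1) (Suc k)) = k + 1"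
  "2 * card (dominating_sets_ending_at (3 * k) (Suc k)) = k * (k + 3)"
proof (induction k)
  case 0
  { case 1 show ?case using card_dominating_sets_ending_at_1 by (simp add: numeral_2_eq_2) }
  { case 2 show ?case using card_dominating_sets_ending_at_1 by simp }
  { case 3 show ?case using card_dominating_sets_ending_at_1 by simp }
next
  case (Suc k)
  have rec: "card (dominating_sets_ending_at (3 * Suc k + i) (Suc (Suc k))) =
    card (dominating_sets_ending_at (3 * k + i) (Suc k))
      + card (dominating_sets_ending_at (3 * k + i + 1) (Suc k))
      + card (dominating_sets_ending_at (3 * k + i + 2) (Suc k))" for i
    using card_dominating_sets_ending_at_rec[of "Suc k" "3 * k + i"] by (simp add: add_ac)
  \<comment> \<open>These are the terms of \<open>rec\<close> with \<open>i = 1\<close> and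
    \<open>i = 2\<close> that end too far right for \<open>Suc k\<close> vertices.\<close>
  have zero: "card (dominating_sets_ending_at (3 * k + 3) (Suc k)) = 0"
    "card (dominating_sets_ending_at (3 * k + 4) (Suc k)) = 0"
    by (simp_all add: dominating_sets_ending_at_empty)
  { case 1 show ?case using rec[of 2] Suc.IH zero by (simp add: numeral_eq_Suc) }
  { case 2 show ?case using rec[of 1] Suc.IH zero by (simp add: numeral_eq_Suc) }
  { case 3 show ?case using rec[of 0] Suc.IH by (simp add: algebra_simps) }
qed

section \<open>Transfer from the interval to the path graph\<close>

context
  fixes n :: nat and G :: "'a pair_pre_digraph" and v :: "nat \<Rightarrow> 'a"
  assumes v: "bij_betw v {1..n} (pverts G)"
    and arcs: "parcs G = {(v i, v j) | i j. i \<in> {1..n} \<and> j \<in> {1..n} \<and> (j = i + 1 \<or> i = j + 1)}"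
begin

lemma dominating_set_image_iff:
  assumes S: "S \<subseteq> {1..n}"
  shows "dominating_set G (v ` S) \<longleftrightarrow> path_dominates S n"
proof -
  have inj: "inj_on v {1..n}" and img: "pverts G = v ` {1..n}"
    using v by (auto simp: bij_betw_def)
  have mem: "v i \<in> v ` S \<longleftrightarrow> i \<in> S" if "i \<in> {1..n}" for i
    using inj_on_image_mem_iff[OF inj that S] .
  have arc: "(v i, v j) \<in> parcs G \<longleftrightarrow> j = i + 1 \<or> i = j + 1" if ij: "i \<in> {1..n}" "j \<in> {1..n}" for i j
    using ij inj by (auto simp: arcs inj_on_eq_iff[OF inj])
  have "dominating_set G (v ` S) \<longleftrightarrow>
      (\<forall>i\<in>{1..n}. i \<notin> S \<longrightarrow> (\<exists>u\<in>S. (v i, v u) \<in> parcs G))"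
    using S mem unfolding dominating_set_def img by blast
  also have "\<dots> \<longleftrightarrow> (\<forall>i\<in>{1..n}. i \<notin> S \<longrightarrow> (\<exists>u\<in>S. u = i + 1 \<or> i = u + 1))"
    using S arc by blast
  \<comment> \<open>The two inequalities say that \<open>u\<close> and \<open>i\<close> differ by at
    most 1. The case \<open>u = i\<close> absorbs the premise \<open>i \<notin> S\<close>.\<close>
  also have "\<dots> \<longleftrightarrow> path_dominates S n"
    unfolding path_dominates_def
  proof (intro ball_cong refl)
    fix i :: nat
    have "u \<le> i + 1 \<and> i \<le> u + 1 \<longleftrightarrow> u = i \<or> u = i + 1 \<or> i = u + 1" for u
      by auto
    then show "(i \<notin> S \<longrightarrow> (\<exists>u\<in>S. u = i + 1 \<or> i = u + 1)) \<longleftrightarrow>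
        (\<exists>u\<in>S. u \<le> i + 1 \<and> i \<le> u + 1)"
      by (simp only: bex_disj_distrib) auto
  qed
  finally show ?thesis .
qed

lemma dominating_sets_eq_image:
  "{S. dominating_set G S \<and> card S = m} = image v ` path_dominating_sets n m"
proof -
  have inj: "inj_on v {1..n}" and img: "pverts G = v ` {1..n}"
    using v by (auto simp: bij_betw_def)
  have card: "card (v ` S) = card S" if "S \<subseteq> {1..n}" for S
    using inj_on_subset[OF inj that] by (rule card_image)
  show ?thesis
  proof (intro equalityI subsetI)
    fix T assume T: "T \<in> {S. dominating_set G S \<and> card S = m}"
    then obtain S where "S \<subseteq> {1..n}" "T = v ` S"
      unfolding dominating_set_def img by (auto simp: subset_image_iff)
    with T card show "T \<in> image v ` path_dominating_sets n m"
      by (auto simp: path_dominating_sets_def dominating_set_image_iff)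
  qed (auto simp: path_dominating_sets_def dominating_set_image_iff card)
qed

text \<open>By the second assumption, fewer than \<open>m\<close> vertices dominate at most
  \<open>3 * m - 3 < n\<close> vertices. So \<open>m\<close> is the domination number as soon as
  some dominating set has size \<open>m\<close>.\<close>

lemma dominion_path:
  assumes ne: "path_dominating_sets n m \<noteq> {}" and m: "3 * m < n + 3"
  shows "dominion G = card (path_dominating_sets n m)"
proof -
  have ex: "(\<exists>S. dominating_set G S \<and> card S = k) \<longleftrightarrow> path_dominating_sets n k \<noteq> {}" for k
    using dominating_sets_eq_image[of k] by blast
  have "domination_number G = m"
    unfolding domination_number_def ex
  proof (rule Least_equality)
    show "m \<le> k" if "path_dominating_sets n k \<noteq> {}" for k
      using that path_dominating_sets_empty[of k n] m by linarith
  qed (rule ne)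
  then have "dominion G = card (image v ` path_dominating_sets n m)"
    unfolding dominion_def gamma_set_def using dominating_sets_eq_image by simp
  also have "\<dots> = card (path_dominating_sets n m)"
  proof (rule card_image)
    have "inj_on (image v) (Pow {1..n})"
      using v by (simp add: bij_betw_def inj_on_image_Pow)
    then show "inj_on (image v) (path_dominating_sets n m)"
      by (rule inj_on_subset) (auto simp: path_dominating_sets_def)
  qed
  finally show ?thesis .
qed

end

section \<open>Evaluation by the residue of \<open>n\<close> modulo 3\<close>

theorem theorem2p5:
  fixes n :: nat and G :: "'a pair_pre_digraph"
  assumes "n \<ge> 2" and "is_path_graph n G"
  shows "real (dominion G) =
    (if n mod 3 = 0 then 1
     else if n mod 3 = 1 then (real n + 2) * (real n + 11) / 18 - 1
     else of_int \<lceil>real n / 3\<rceil> + 1)"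
proof -
  obtain v where v: "bij_betw v {1..n} (pverts G)"
    and arcs: "parcs G = {(v i, v j) | i j. i \<in> {1..n} \<and> j \<in> {1..n} \<and> (j = i + 1 \<or> i = j + 1)}"
    using assms(2) unfolding is_path_graph_def by blast
  \<comment> \<open>A positive count serves as the existence proof, so counting the sets of size
    \<open>m\<close> also identifies the domination number.\<close>
  have dominion: "dominion G = card (path_dominating_sets n m)"
    if "card (path_dominating_sets n m) > 0" "3 * m < n + 3" for m
    using dominion_path[OF v arcs, of m] that by fastforce
  \<comment> \<open>Since \<open>n \<ge> 2\<close>, the residue 1 starts at 4, which makes
    \<open>m = k + 2\<close> there and \<open>m = k + 1\<close> in the other two cases.\<close>
  consider k where "n = 3 * k + 3" | k where "n = 3 * k + 4" | k where "n = 3 * k + 2"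
  proof -
    have "n = 3 * ((n - 3) div 3) + 3 \<or> n = 3 * ((n - 4) div 3) + 4 \<or> n = 3 * ((n - 2) div 3) + 2"
      using assms(1) by presburger
    then show ?thesis using that by blast
  qed
  then show ?thesis
  proof cases
    case (1 k)
    \<comment> \<open>Slack 0: no set of this size ends at \<open>n\<close>, and exactly one ends at
      \<open>n - 1\<close>.\<close>
    have "card (path_dominating_sets n (Suc k)) = 1"
      using 1 card_path_dominating_sets[of "3 * k + 1" "Suc k"] card_dominating_sets_ending_at(1)[of k]
        dominating_sets_ending_at_empty[of "Suc k" "3 * k + 3"]
      by (simp add: numeral_eq_Suc)
    moreover have "n mod 3 = 0" using 1 by presburger
    ultimately show ?thesis using dominion[of "Suc k"] 1 by simp
  next
    case (2 k)
    let ?c = "card (path_dominating_sets n (Suc (Suc k)))"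
    \<comment> \<open>Slack 2: the first summand counts twice the sets ending at
      \<open>n - 1\<close>, the second twice those ending at \<open>n\<close>.\<close>
    have "2 * ?c = Suc k * (Suc k + 3) + 2 * (Suc k + 1)"
      using 2 card_path_dominating_sets[of "3 * k + 2" "Suc (Suc k)"]
        card_dominating_sets_ending_at(2,3)[of "Suc k"]
      by (simp add: numeral_eq_Suc)
    then have c: "2 * ?c = k * k + 7 * k + 8" by (simp add: algebra_simps)
    then have "dominion G = ?c"
      using 2 by (intro dominion) auto
    moreover have "2 * real ?c = real k * real k + 7 * real k + 8"
      using arg_cong[OF c, of real] by simp
    moreover have "n mod 3 = 1" using 2 by presburger
    \<comment> \<open>For \<open>n = 3 * k + 4\<close> the claimed value is
      \<open>(k + 2) * (k + 5) / 2 - 1\<close>.\<close>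
    ultimately show ?thesis using 2 by (simp add: field_simps)
  next
    case (3 k)
    \<comment> \<open>Slack 1: \<open>k + 1\<close> sets end at \<open>n - 1\<close> and one ends at
      \<open>n\<close>.\<close>
    have "card (path_dominating_sets n (Suc k)) = k + 2"
      using 3 card_path_dominating_sets[of "3 * k" "Suc k"] card_dominating_sets_ending_at(1,2)[of k]
      by simp
    moreover have "n mod 3 = 2" using 3 by presburger
    moreover have "\<lceil>real n / 3\<rceil> = int k + 1"
      using 3 by (intro ceiling_unique) (auto simp: field_simps)
    ultimately show ?thesis using dominion[of "Suc k"] 3 by simp
  qed
qed

end
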